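(* For $n\ge 0$ let $b_{n}$ be the number of words $w=w_1\cdots w_n\in\{1,2,3,4\}^n$ in which each letter differs from at least one of its neighbors by $1$ or less. Then $$\sum_{n\ge 0}b_nt^n=\frac{1-3t+8t^2-3t^3+t^4}{1-3t-2t^2+t^3-t^4},$$ and consequently $$b_n=3b_{n-1}+2b_{n-2}-b_{n-3}+b_{n-4}\qquad\text{for } n>5 .$$
   Context: The neighbors of the letter $w_i$ in $w=w_1\cdots w_n$ are $w_{i-1}$ (if $i\ge 2$) and $w_{i+1}$ (if $i\le n-1$). So $b_n$ counts words such that for every $i$, $|w_i-w_{i-1}|\le 1$ or $|w_i-w_{i+1}|\le 1$ for some existing neighbor; the empty word counts, so $b_0=1$, and a one-letter word has no neighbors, so $b_1=0$. *)

theory Defs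
  imports Complex_Main "HOL-Computational_Algebra.Formal_Power_Series"
begin

(* Positions are 0-based: the letter w_(i+1) of the word is w ! i. *)

definition neighbors :: "int list \<Rightarrow> nat \<Rightarrow> int set" where
  "neighbors w i =
     {w ! j | j. j < length w \<and> (Suc j = i \<or> j = Suc i)}"

definition words :: "nat \<Rightarrow> int list set" where
  "words n =
     {w. length w = n \<and> set w \<subseteq> {1..4} \<and>
         (\<forall>i<n. \<exists>x\<in>neighbors w i. \<bar>w ! i - x\<bar> \<le> 1)}"

definition b :: "nat \<Rightarrow> nat" where
  "b n = card (words n)"

end

(*
  Transfer matrix method. Read a word from left to right and keep as state the current letter together
  with the information whether its left neighbor is close to it. The reflection x -> 5 - x identifies
  the letters 1, 4 and the letters 2, 3, which leaves four states; the recurrence for b expresses that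
  the 4x4 transfer matrix is annihilated by its characteristic polynomial.
*)
theory Submission
  imports Defs
begin

lemma neighbors_Cons_0: "neighbors (a # w) 0 = (if w = [] then {} else {hd w})"
  by (auto simp: neighbors_def hd_conv_nth)

lemma neighbors_Cons_Suc:
  "neighbors (a # w) (Suc i) = neighbors w i \<union> (if i = 0 then {a} else {})"
  (is "?L = ?R")
proof
  show "?L \<subseteq> ?R"
  proof
    fix x
    assume "x \<in> ?L"
    then obtain j where "x = (a # w) ! j" "j < Suc (length w)" "j = i \<or> j = Suc (Suc i)"
      by (auto simp: neighbors_def)
    then show "x \<in> ?R" by (cases j) (auto simp: neighbors_def)
  qed
  have "x \<in> ?L" if "x = (a # w) ! j" "j < Suc (length w)" "j = i \<or> j = Suc (Suc i)" for x j
    using that by (auto simp: neighbors_def)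
  \<comment> \<open>Positions of \<open>w\<close> shift up by one in \<open>a # w\<close>; position
    0 supplies the extra neighbor \<open>a\<close>.\<close>
  from this[of _ "Suc _"] this[of a 0] show "?R \<subseteq> ?L"
    by (auto simp: neighbors_def[of w])
qed

text \<open>The flag \<open>s\<close> says whether the letter \<open>a\<close> preceding the list already has a close left neighbor.\<close>

fun close_from :: "bool \<Rightarrow> int \<Rightarrow> int list \<Rightarrow> bool" where
  "close_from s a [] = s"
| "close_from s a (y # w) =
     ((s \<or> \<bar>a - y\<bar> \<le> 1) \<and> close_from (\<bar>a - y\<bar> \<le> 1) y w)"

text \<open>Prepending \<open>a\<close> to \<open>y # w\<close> gives a new neighbor to
  \<open>y\<close> only, and the flag passed on by \<open>close_from\<close> records whether it is
  close. The exemption \<open>i = 0 \<and> s\<close> stands for a left neighbor of \<open>a\<close>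
  outside the list.\<close>

lemma close_from_iff:
  "close_from s a w \<longleftrightarrow>
     (\<forall>i<Suc (length w). i = 0 \<and> s \<or> (\<exists>x\<in>neighbors (a # w) i. \<bar>(a # w) ! i - x\<bar> \<le> 1))"
proof (induction w arbitrary: s a)
  case Nil
  then show ?case by (simp add: neighbors_Cons_0)
next
  case (Cons y w)
  have "i = 0 \<and> \<bar>a - y\<bar> \<le> 1 \<or> (\<exists>x\<in>neighbors (y # w) i. \<bar>(y # w) ! i - x\<bar> \<le> 1) \<longleftrightarrow>
      (\<exists>x\<in>neighbors (a # y # w) (Suc i). \<bar>(a # y # w) ! Suc i - x\<bar> \<le> 1)" for i
    by (cases "i = 0") (auto simp: neighbors_Cons_Suc[of a] abs_minus_commute)
  then show ?case
    by (simp add: Cons.IH All_less_Suc2[of "Suc (length w)"] neighbors_Cons_0[of a]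
        del: nth_Cons_Suc)
qed

definition completions :: "nat \<Rightarrow> bool \<Rightarrow> int \<Rightarrow> int list set" where
  "completions n s a = {w. length w = n \<and> set w \<subseteq> {1..4} \<and> close_from s a w}"

lemma finite_completions: "finite (completions n s a)"
  by (rule finite_subset[OF _ finite_lists_length_eq[of "{1..4::int}" n]])
    (auto simp: completions_def)

lemma card_Cons_completions:
  assumes "finite Y"
  shows "card (\<Union>y\<in>Y. (#) y ` completions n (s y) y) = (\<Sum>y\<in>Y. card (completions n (s y) y))"
  using assms by (subst card_UN_disjoint) (auto simp: finite_completions card_image)

lemma b_0: "b 0 = 1"
proof -
  have "words 0 = {[]}" by (auto simp: words_def)
  then show ?thesis by (simp add: b_def)
qed

text \<open>The first letter has no left neighbor, hence the flag \<open>False\<close>.\<close>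

lemma b_Suc: "b (Suc n) = (\<Sum>a=1..4. card (completions n False a))"
proof -
  have "words (Suc n) = (\<Union>a\<in>{1..4}. (#) a ` completions n False a)"
    by (auto simp: words_def completions_def close_from_iff length_Suc_conv image_iff)
  then show ?thesis by (simp add: b_def card_Cons_completions)
qed

lemma card_completions_0: "card (completions 0 s a) = of_bool s"
proof -
  have "completions 0 s a = (if s then {[]} else {})" by (auto simp: completions_def)
  then show ?thesis by simp
qed

lemma card_completions_Suc:
  "card (completions (Suc n) s a) =
     (\<Sum>y=1..4. if s \<or> \<bar>a - y\<bar> \<le> 1 then card (completions n (\<bar>a - y\<bar> \<le> 1) y) else 0)"
proof -
  let ?Y = "{y \<in> {1..4}. s \<or> \<bar>a - y\<bar> \<le> 1}"
  have finite: "finite ?Y" by (rule finite_subset[of _ "{1..4}"]) auto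
  have eq: "completions (Suc n) s a = (\<Union>y\<in>?Y. (#) y ` completions n (\<bar>a - y\<bar> \<le> 1) y)"
    by (auto simp: completions_def length_Suc_conv image_iff)
  show ?thesis
    unfolding eq card_Cons_completions[OF finite] by (subst sum.inter_filter) simp_all
qed

lemma sum_letters: "(\<Sum>y=1..4::int. f y) = f 1 + f 2 + f 3 + f 4"
proof -
  have "{1..4::int} = {1, 2, 3, 4}" by auto
  then show ?thesis by (simp add: add.assoc)
qed

text \<open>The map x -> 5 - x preserves distances. Both equations go through one induction because
  the recursion for each letter involves all four letters.\<close>

lemma card_completions_reflect:
  "card (completions n s 4) = card (completions n s 1)"
  "card (completions n s 3) = card (completions n s 2)"
  by (induction n arbitrary: s)
    (simp_all add: card_completions_0 card_completions_Suc sum_letters)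

lemma b_Suc_reduced:
  "b (Suc n) = 2 * card (completions n False 1) + 2 * card (completions n False 2)"
  by (simp add: b_Suc sum_letters card_completions_reflect)

text \<open>The rows of the 4x4 transfer matrix, with the letters 3 and 4 folded into 2 and
  1.\<close>

lemma transfer:
  "card (completions (Suc n) True 1) = card (completions n True 1) + card (completions n False 1)
     + card (completions n True 2) + card (completions n False 2)"
  "card (completions (Suc n) False 1) = card (completions n True 1) + card (completions n True 2)"
  "card (completions (Suc n) True 2) = card (completions n True 1) + card (completions n False 1)
     + 2 * card (completions n True 2)"
  "card (completions (Suc n) False 2) = card (completions n True 1) + 2 * card (completions n True 2)"
  by (simp_all add: card_completions_Suc sum_letters card_completions_reflect)

lemma b_values: "b (Suc 0) = 0" "b 2 = 10" "b 3 = 26" "b 4 = 100"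
  by (simp_all add: eval_nat_numeral b_Suc_reduced transfer card_completions_0)

text \<open>For \<open>n \<ge> 5\<close> all five indices are positive, so
  \<open>b_Suc_reduced\<close> and \<open>transfer\<close> turn both sides into the same linear
  combination of the four counts at level \<open>m\<close>. At 4 the recurrence would give 99
  instead of 100; the difference is the last term of the numerator.\<close>

lemma b_recurrence:
  assumes "n \<ge> 5"
  shows "int (b n) = 3 * int (b (n - 1)) + 2 * int (b (n - 2)) - int (b (n - 3)) + int (b (n - 4))"
proof -
  obtain m where "n = 5 + m" using assms le_Suc_ex by blast
  then have n: "n = Suc (Suc (Suc (Suc (Suc m))))" "n - 1 = Suc (Suc (Suc (Suc m)))"
      "n - 2 = Suc (Suc (Suc m))" "n - 3 = Suc (Suc m)" "n - 4 = Suc m"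
    by simp_all
  show ?thesis
    \<comment> \<open>The differences are rewritten first, since \<open>n(1)\<close> would also
      replace the \<open>n\<close> inside them.\<close>
    unfolding n(2-) unfolding n(1) by (simp add: b_Suc_reduced transfer)
qed

theorem mainTheorem9:
  shows "(Abs_fps (\<lambda>n. of_nat (b n)) :: rat fps) =
           (1 - 3 * fps_X + 8 * fps_X ^ 2 - 3 * fps_X ^ 3 + fps_X ^ 4) /
           (1 - 3 * fps_X - 2 * fps_X ^ 2 + fps_X ^ 3 - fps_X ^ 4)
         \<and> (\<forall>n>5. int (b n) =
               3 * int (b (n - 1)) + 2 * int (b (n - 2)) - int (b (n - 3)) + int (b (n - 4)))"
proof
  let ?B = "Abs_fps (\<lambda>n. of_nat (b n)) :: rat fps"
  let ?N = "1 - 3 * fps_X + 8 * fps_X ^ 2 - 3 * fps_X ^ 3 + fps_X ^ 4 :: rat fps"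
  let ?D = "1 - 3 * fps_X - 2 * fps_X ^ 2 + fps_X ^ 3 - fps_X ^ 4 :: rat fps"
  have "?B * ?D = ?N"
  proof (rule fps_ext)
    fix n :: nat
    \<comment> \<open>Every term becomes a constant times a power of \<open>fps_X\<close> times the
      series, the form in which coefficients are read off as shifts; \<open>fps_X ^ 1\<close> is
      kept for this reason.\<close>
    have expand: "?B * ?D = ?B - fps_const 3 * (fps_X ^ 1 * ?B) - fps_const 2 * (fps_X ^ 2 * ?B)
        + fps_X ^ 3 * ?B - fps_X ^ 4 * ?B"
      by (simp add: algebra_simps flip: numeral_fps_const)
    have N: "?N = 1 - fps_const 3 * fps_X ^ 1 + fps_const 8 * fps_X ^ 2 - fps_const 3 * fps_X ^ 3
        + fps_X ^ 4"
      by (simp flip: numeral_fps_const)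
    consider "n = 0" | "n = 1" | "n = 2" | "n = 3" | "n = 4" | "n \<ge> 5" by linarith
    then show "fps_nth (?B * ?D) n = fps_nth ?N n"
    proof cases
      case 6
      \<comment> \<open>From degree 5 on the numerator vanishes, so the recurrence, carried from
        \<open>int\<close> to \<open>rat\<close>, is what remains to be shown.\<close>
      from b_recurrence[OF this] have "of_nat (b n) = (3 * of_nat (b (n - 1)) + 2 * of_nat (b (n - 2))
          - of_nat (b (n - 3)) + of_nat (b (n - 4)) :: rat)"
        by (metis (mono_tags) of_int_add of_int_diff of_int_mult of_int_numeral of_int_of_nat_eq)
      with 6 show ?thesis
        unfolding expand N by (simp add: fps_X_power_mult_nth fps_X_power_nth del: power_one_right)
    qed (unfold expand N, simp_all add: fps_X_power_mult_nth fps_X_power_nth b_0 b_values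
          del: power_one_right)
  qed
  moreover have "fps_nth ?D 0 \<noteq> 0" by simp
  then have "?D \<noteq> 0" by (metis fps_zero_nth)
  ultimately show "?B = ?N / ?D" by (metis nonzero_mult_div_cancel_right)
qed (simp add: b_recurrence)

end
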